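(* Let $(D,\tau,d,\Delta)$ be an instance of TMO in which $t$ is reachable from $s$. Then there exists a convoy routing $(\boldsymbol{P},\boldsymbol{\sigma})$ whose induced train routing is an optimal feasible train routing, i.e. its makespan $\max_{i\in[k]}\{\tau(P_i)+(\sigma_i-1)\Delta\}$ equals the minimum makespan over all feasible train routings.
   Context: An instance of Train Makespan Optimization (TMO) is $(D,\tau,d,\Delta)$ where $D=(V,A)$ is a directed graph (parallel arcs allowed) with a source $s$ and sink $t$, $\tau:A\to\mathbb{Z}_{\ge0}$ are travel times, $d\in\mathbb{Z}_{\ge1}$ is the number of identical trains and $\Delta\in\mathbb{Z}_{\ge1}$ is the headway. A train routing $(\boldsymbol{P},\boldsymbol{\lambda})$ consists, for each train $i\in[d]$, of an $s$-$t$-path $P_i$ in $D$ and an entry function $\lambda_i:P_i\to\mathbb{Z}_{\ge0}$ ($\lambda_i(a)$ is the time train $i$ enters arc $a$). It is feasible if (i) $\lambda_i(a)+\tau_a\le\lambda_i(a')$ for every $i$ and every pair of consecutive arcs $a,a'$ on $P_i$ (waiting at nodes is allowed), and (ii) $|\lambda_i(a)-\lambda_{i'}(a)|\ge\Delta$ for all $i\neq i'$ and all $a\in P_i\cap P_{i'}$. Its makespan is $\max_{i\in[d]}\max_{a\in P_i}(\lambda_i(a)+\tau_a)$. A convoy routing $(\boldsymbol{P},\boldsymbol{\sigma})$ consists of $k\le d$ pairwise arc-disjoint $s$-$t$-paths $P_1,\dots,P_k$ and $\boldsymbol{\sigma}\in\mathbb{Z}_{\ge1}^k$ with $\sum_i\sigma_i=d$;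 it induces the feasible train routing in which $\sigma_i$ trains traverse $P_i$ without waiting, the $j$-th of them ($j=1,\dots,\sigma_i$) entering the first arc of $P_i$ at time $(j-1)\Delta$. Its makespan is $\max_{i\in[k]}\{\tau(P_i)+(\sigma_i-1)\Delta\}$, where $\tau(P)=\sum_{a\in P}\tau_a$. *)

theory Defs
  imports Main
begin

text \<open>A directed multigraph is given by a finite arc set A (of some type 'a) together with
  tail and head maps src, trg :: 'a => 'v.  Parallel arcs are allowed since distinct arcs may
  share endpoints.  A path is a nonempty list of arcs in A, consecutive arcs are linked,
  and no vertex repeats (simple path).\<close>

definition is_st_path :: "'a set \<Rightarrow> ('a \<Rightarrow> 'v) \<Rightarrow> ('a \<Rightarrow> 'v) \<Rightarrow> 'v \<Rightarrow> 'v \<Rightarrow> 'a list \<Rightarrow> bool" where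
  "is_st_path A src trg s t P \<longleftrightarrow>
     P \<noteq> [] \<and> set P \<subseteq> A \<and> src (hd P) = s \<and> trg (last P) = t \<and>
     (\<forall>j. Suc j < length P \<longrightarrow> trg (P ! j) = src (P ! Suc j)) \<and>
     distinct (src (hd P) # map trg P)"

definition reachable :: "'a set \<Rightarrow> ('a \<Rightarrow> 'v) \<Rightarrow> ('a \<Rightarrow> 'v) \<Rightarrow> 'v \<Rightarrow> 'v \<Rightarrow> bool" where
  "reachable A src trg s t \<longleftrightarrow> (\<exists>P. is_st_path A src trg s t P)"

definition path_time :: "('a \<Rightarrow> nat) \<Rightarrow> 'a list \<Rightarrow> nat" where
  "path_time \<tau> P = sum_list (map \<tau> P)"

text \<open>Train routing: trains are indexed 0..d-1; Ps i is the path of train i and lam i a the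
  time train i enters arc a (only relevant for arcs a on Ps i).\<close>
definition feasible_train_routing ::
  "'a set \<Rightarrow> ('a \<Rightarrow> 'v) \<Rightarrow> ('a \<Rightarrow> 'v) \<Rightarrow> 'v \<Rightarrow> 'v \<Rightarrow> ('a \<Rightarrow> nat) \<Rightarrow> nat \<Rightarrow> nat
    \<Rightarrow> (nat \<Rightarrow> 'a list) \<Rightarrow> (nat \<Rightarrow> 'a \<Rightarrow> nat) \<Rightarrow> bool" where
  "feasible_train_routing A src trg s t \<tau> d \<Delta> Ps lam \<longleftrightarrow>
     (\<forall>i<d. is_st_path A src trg s t (Ps i)) \<and>
     (\<forall>i<d. \<forall>j. Suc j < length (Ps i) \<longrightarrow>
         lam i (Ps i ! j) + \<tau> (Ps i ! j) \<le> lam i (Ps i ! Suc j)) \<and>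
     (\<forall>i<d. \<forall>i'<d. i \<noteq> i' \<longrightarrow> (\<forall>a \<in> set (Ps i) \<inter> set (Ps i').
         \<bar>int (lam i a) - int (lam i' a)\<bar> \<ge> int \<Delta>))"

definition train_makespan :: "('a \<Rightarrow> nat) \<Rightarrow> nat \<Rightarrow> (nat \<Rightarrow> 'a list) \<Rightarrow> (nat \<Rightarrow> 'a \<Rightarrow> nat) \<Rightarrow> nat" where
  "train_makespan \<tau> d Ps lam = Max {lam i a + \<tau> a | i a. i < d \<and> a \<in> set (Ps i)}"

definition convoy_routing ::
  "'a set \<Rightarrow> ('a \<Rightarrow> 'v) \<Rightarrow> ('a \<Rightarrow> 'v) \<Rightarrow> 'v \<Rightarrow> 'v \<Rightarrow> nat \<Rightarrow> nat \<Rightarrow> (nat \<Rightarrow> 'a list) \<Rightarrow> (nat \<Rightarrow> nat) \<Rightarrow> bool" where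
  "convoy_routing A src trg s t d k Q \<sigma> \<longleftrightarrow>
     k \<le> d \<and>
     (\<forall>i<k. is_st_path A src trg s t (Q i)) \<and>
     (\<forall>i<k. \<forall>i'<k. i \<noteq> i' \<longrightarrow> set (Q i) \<inter> set (Q i') = {}) \<and>
     (\<forall>i<k. \<sigma> i \<ge> 1) \<and>
     (\<Sum>i<k. \<sigma> i) = d"

definition convoy_makespan :: "('a \<Rightarrow> nat) \<Rightarrow> nat \<Rightarrow> nat \<Rightarrow> (nat \<Rightarrow> 'a list) \<Rightarrow> (nat \<Rightarrow> nat) \<Rightarrow> nat" where
  "convoy_makespan \<tau> \<Delta> k Q \<sigma> = Max {path_time \<tau> (Q i) + (\<sigma> i - 1) * \<Delta> | i. i < k}"

text \<open>Induced train routing.  Train n (n < d) belongs to convoy path conv_idx \<sigma> k n, namely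
  the i with sum_{l<i} sigma l <= n < sum_{l<=i} sigma l, and is the (conv_pos + 1)-th train on
  it; it enters the first arc at time conv_pos * Delta and travels without waiting.\<close>
definition conv_idx :: "(nat \<Rightarrow> nat) \<Rightarrow> nat \<Rightarrow> nat" where
  "conv_idx \<sigma> n = (LEAST i. n < (\<Sum>l\<le>i. \<sigma> l))"

definition conv_pos :: "(nat \<Rightarrow> nat) \<Rightarrow> nat \<Rightarrow> nat" where
  "conv_pos \<sigma> n = n - (\<Sum>l<conv_idx \<sigma> n. \<sigma> l)"

definition induced_paths :: "(nat \<Rightarrow> 'a list) \<Rightarrow> (nat \<Rightarrow> nat) \<Rightarrow> nat \<Rightarrow> 'a list" where
  "induced_paths Q \<sigma> n = Q (conv_idx \<sigma> n)"

definition induced_entry :: "('a \<Rightarrow> nat) \<Rightarrow> nat \<Rightarrow> (nat \<Rightarrow> 'a list) \<Rightarrow> (nat \<Rightarrow> nat) \<Rightarrow> nat \<Rightarrow> 'a \<Rightarrow> nat" where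
  "induced_entry \<tau> \<Delta> Q \<sigma> n a =
     conv_pos \<sigma> n * \<Delta> + path_time \<tau> (takeWhile (\<lambda>b. b \<noteq> a) (Q (conv_idx \<sigma> n)))"

end

theory Submission
  imports Defs
begin

text \<open>Fix a feasible train routing with makespan T. At every inner node, match incoming with outgoing
  arcs, where only a train passing from one to the other may link the two; the incoming arc prefers
  late trains and the outgoing arc prefers early ones. In addition the two ends of an arc may be
  linked with each other, by a skip labelled with a time, which takes the arc out of use. In a stable
  matching the remaining arcs form arc-disjoint chains from s to t, along which the linking trains
  appear in temporal order, and every train has an arc at which it lies between the incoming and the
  outgoing linking train of a chain. Charging each train to the chain of such an arc and adding up
  headways shows that a chain of length L charged with n trains satisfies L + (n - 1) * Delta <= T,
  so the chains, shortened to simple paths, form a convoy routing of makespan at most T.\<close>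

section \<open>Stable matchings by a monotone fixed point\<close>

lemma finite_ex_max:
  fixes f :: "'i \<Rightarrow> nat"
  assumes "finite S" "S \<noteq> {}"
  obtains m where "m \<in> S" "\<And>i. i \<in> S \<Longrightarrow> f i \<le> f m"
proof -
  have "Max (f ` S) \<in> f ` S" using assms by (intro Max_in) auto
  then obtain m where "m \<in> S" "f m = Max (f ` S)" by auto
  then show thesis using assms(1) by (intro that[of m]) auto
qed

lemma finite_ex_min:
  fixes f :: "'i \<Rightarrow> nat"
  assumes "finite S" "S \<noteq> {}"
  obtains m where "m \<in> S" "\<And>i. i \<in> S \<Longrightarrow> f m \<le> f i"
  using ex_is_arg_min_if_finite[OF assms, of f] by (auto simp: is_arg_min_linorder)

text \<open>The rejection maps \<open>Rl\<close> and \<open>Rr\<close> are monotone, so alternating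
  them has a Knaster-Tarski fixed point. It yields the edges \<open>X\<close> offered to the left
  ends and the edges \<open>Y\<close> offered to the right ends; those in both form the matching.
  Left ends prefer large \<open>p\<close>, right ends small \<open>q\<close>.\<close>

lemma stable_matching_exists:
  fixes E :: "'e set" and l :: "'e \<Rightarrow> 'x" and r :: "'e \<Rightarrow> 'y" and p q :: "'e \<Rightarrow> nat"
  assumes fin: "finite E"
    and inj_p: "\<And>e f. \<lbrakk>e \<in> E; f \<in> E; l e = l f; p e = p f\<rbrakk> \<Longrightarrow> e = f"
    and inj_q: "\<And>e f. \<lbrakk>e \<in> E; f \<in> E; r e = r f; q e = q f\<rbrakk> \<Longrightarrow> e = f"
  obtains M where "M \<subseteq> E" "inj_on l M" "inj_on r M"
    "\<And>e. e \<in> E \<Longrightarrow> (\<exists>m\<in>M. l m = l e \<and> p e \<le> p m) \<or> (\<exists>m\<in>M. r m = r e \<and> q m \<le> q e)"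
proof -
  define Rl where "Rl X = {e\<in>X. \<exists>f\<in>X. l f = l e \<and> p e < p f}" for X
  define Rr where "Rr X = {e\<in>X. \<exists>f\<in>X. r f = r e \<and> q f < q e}" for X
  have "mono (\<lambda>X. E - Rr (E - Rl X))"
    by (rule monoI) (auto simp: Rl_def Rr_def)
  then obtain X where X: "X = E - Rr (E - Rl X)"
    using lfp_unfold by blast
  define Y where "Y = E - Rl X"
  have sub: "X \<subseteq> E" "Y \<subseteq> E" using X Y_def by blast+
  have X': "X = E - Rr Y" using X Y_def by simp
  define M where "M = X \<inter> Y"
  have M_l: "M = X - Rl X" using sub Y_def M_def by blast
  have M_r: "M = Y - Rr Y" using sub X' M_def by blast
  \<comment> \<open>The best edge offered to a left end is not rejected there, hence lies in
    \<open>M\<close>.\<close>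
  have bestl: "\<exists>m\<in>M. l m = l e \<and> p e \<le> p m" if "e \<in> X" for e
  proof -
    define F where "F = {f\<in>X. l f = l e}"
    have F: "finite F" "F \<noteq> {}" using that sub fin by (auto simp: F_def intro: finite_subset)
    then obtain m where m: "m \<in> F" "\<And>f. f \<in> F \<Longrightarrow> p f \<le> p m"
      using finite_ex_max by metis
    then have "m \<in> M" unfolding M_l Rl_def F_def by force
    then show ?thesis using m that by (auto simp: F_def)
  qed
  have bestr: "\<exists>m\<in>M. r m = r e \<and> q m \<le> q e" if "e \<in> Y" for e
  proof -
    define F where "F = {f\<in>Y. r f = r e}"
    have F: "finite F" "F \<noteq> {}" using that sub fin by (auto simp: F_def intro: finite_subset)
    then obtain m where m: "m \<in> F" "\<And>f. f \<in> F \<Longrightarrow> q m \<le> q f"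
      using finite_ex_min by metis
    then have "m \<in> M" unfolding M_r Rr_def F_def by force
    then show ?thesis using m that by (auto simp: F_def)
  qed
  show thesis
  proof (rule that[of M])
    show "M \<subseteq> E" using sub M_def by blast
    show "inj_on l M"
      unfolding M_l Rl_def inj_on_def using inj_p sub by (auto) (metis linorder_neqE_nat subsetD)
    show "inj_on r M"
      unfolding M_r Rr_def inj_on_def using inj_q sub by (auto) (metis linorder_neqE_nat subsetD)
    show "(\<exists>m\<in>M. l m = l e \<and> p e \<le> p m) \<or> (\<exists>m\<in>M. r m = r e \<and> q m \<le> q e)" if "e \<in> E" for e
    proof (cases "e \<in> X")
      case True then show ?thesis using bestl by blast
    next
      case False
      \<comment> \<open>An edge is missing from \<open>X\<close> only if its right end rejects it,
        so it was offered there.\<close>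
      then have "e \<in> Y" using X' that Rr_def by blast
      then show ?thesis using bestr by blast
    qed
  qed
qed

section \<open>Walks, which unlike simple paths may be empty and revisit vertices\<close>

fun walk :: "('a \<Rightarrow> 'v) \<Rightarrow> ('a \<Rightarrow> 'v) \<Rightarrow> 'v \<Rightarrow> 'a list \<Rightarrow> 'v \<Rightarrow> bool" where
  "walk src trg u [] v \<longleftrightarrow> u = v"
| "walk src trg u (e # P) v \<longleftrightarrow> src e = u \<and> walk src trg (trg e) P v"

lemma walk_append:
  "walk src trg u (P @ Q) v \<longleftrightarrow> (\<exists>w. walk src trg u P w \<and> walk src trg w Q v)"
  by (induction P arbitrary: u) auto

lemma walk_iff_successively:
  "P \<noteq> [] \<Longrightarrow> walk src trg u P v \<longleftrightarrow>
    src (hd P) = u \<and> trg (last P) = v \<and> successively (\<lambda>e f. trg e = src f) P"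
  by (induction P arbitrary: u rule: induct_list012) auto

lemma is_st_path_iff_walk:
  "is_st_path A src trg s t P \<longleftrightarrow>
    P \<noteq> [] \<and> set P \<subseteq> A \<and> walk src trg s P t \<and> distinct (s # map trg P)"
  by (cases "P = []")
    (auto simp: is_st_path_def walk_iff_successively successively_conv_nth simp del: distinct.simps)

text \<open>Arcs are prepended one by one to a simple walk. If the new start vertex recurs,
  everything up to that visit is cut off, which cannot increase the travel time.\<close>

lemma walk_imp_simple_walk:
  assumes "walk src trg u P v"
  shows "\<exists>Q. walk src trg u Q v \<and> set Q \<subseteq> set P \<and> path_time \<tau> Q \<le> path_time \<tau> P \<and>
    distinct (u # map trg Q)"
  using assms
proof (induction P arbitrary: u)
  case Nil
  then show ?case by (intro exI[of _ "[]"]) auto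
next
  case (Cons e P)
  then obtain Q where Q: "walk src trg (trg e) Q v" "set Q \<subseteq> set P"
    "path_time \<tau> Q \<le> path_time \<tau> P" "distinct (trg e # map trg Q)"
    by fastforce
  consider "u \<notin> set (trg e # map trg Q)" | "u = trg e" | f where "f \<in> set Q" "u = trg f"
    by auto
  then show ?case
  proof cases
    case 1
    then show ?thesis using Q Cons.prems
      by (intro exI[of _ "e # Q"]) (auto simp: path_time_def)
  next
    case 2
    then show ?thesis using Q by (intro exI[of _ Q]) (auto simp: path_time_def)
  next
    case 3
    then obtain Q1 Q2 where "Q = Q1 @ f # Q2" by (auto dest: split_list)
    then show ?thesis using Q 3
      by (intro exI[of _ Q2]) (auto simp: path_time_def walk_append)
  qed
qed

lemma walk_imp_st_path:
  assumes "walk src trg s P t" "set P \<subseteq> A" "s \<noteq> t"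
  obtains Q where "is_st_path A src trg s t Q" "set Q \<subseteq> set P" "path_time \<tau> Q \<le> path_time \<tau> P"
proof -
  obtain Q where "walk src trg s Q t" "set Q \<subseteq> set P" "path_time \<tau> Q \<le> path_time \<tau> P"
    "distinct (s # map trg Q)"
    using walk_imp_simple_walk[OF assms(1), of \<tau>] by blast
  moreover from this have "Q \<noteq> []" using assms(3) by auto
  ultimately show thesis using assms(2) that by (force simp: is_st_path_iff_walk)
qed

section \<open>Chains of a relation and sets of separated values\<close>

lemma forward_chain_exists:
  assumes "wf (R\<inverse>)" and sv: "single_valued R"
  shows "\<exists>W. successively (\<lambda>e f. (e, f) \<in> R) (x # W) \<and> last (x # W) \<notin> Domain R \<and>
    set (x # W) = R\<^sup>* `` {x}"
  using assms(1)
proof (induction x rule: wf_induct_rule)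
  case (less x)
  show ?case
  proof (cases "x \<in> Domain R")
    case False
    then have "R\<^sup>* `` {x} = {x}" by (auto elim: converse_rtranclE)
    then show ?thesis using False by (intro exI[of _ "[]"]) auto
  next
    case True
    then obtain y where y: "(x, y) \<in> R" by blast
    then obtain W where W: "successively (\<lambda>e f. (e, f) \<in> R) (y # W)" "last (y # W) \<notin> Domain R"
      "set (y # W) = R\<^sup>* `` {y}"
      using less by blast
    \<comment> \<open>Single-valuedness forces every walk leaving \<open>x\<close> through
      \<open>y\<close>, so one list captures all reachable elements.\<close>
    have "R\<^sup>* `` {x} = insert x (R\<^sup>* `` {y})"
    proof (intro equalityI subsetI)
      fix z
      assume "z \<in> R\<^sup>* `` {x}"
      then have "(x, z) \<in> R\<^sup>*" by blast
      then show "z \<in> insert x (R\<^sup>* `` {y})"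
        using y sv by (cases rule: converse_rtranclE) (auto dest: single_valuedD)
    qed (use y in \<open>auto intro: converse_rtrancl_into_rtrancl\<close>)
    then show ?thesis using W y by (intro exI[of _ "y # W"]) (auto simp: successively_Cons)
  qed
qed

text \<open>Induction on the cardinality: without the element of largest value \<open>f m\<close>,
  all values are at most \<open>f m - \<Delta>\<close>, which becomes the new upper end.\<close>

lemma separated_card_bound:
  fixes f :: "'i \<Rightarrow> nat"
  assumes "finite S" "S \<noteq> {}" "\<And>i. i \<in> S \<Longrightarrow> x \<le> f i \<and> f i \<le> y"
    "\<And>i j. \<lbrakk>i \<in> S; j \<in> S; i \<noteq> j\<rbrakk> \<Longrightarrow> \<bar>int (f i) - int (f j)\<bar> \<ge> int \<Delta>"
  shows "x + (card S - 1) * \<Delta> \<le> y"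
  using assms
proof (induction "card S" arbitrary: S y)
  case 0
  then show ?case by simp
next
  case (Suc n)
  obtain m where m: "m \<in> S" "\<And>i. i \<in> S \<Longrightarrow> f i \<le> f m"
    using finite_ex_max[OF Suc.prems(1,2)] by blast
  show ?case
  proof (cases "S = {m}")
    case True
    then show ?thesis using Suc.prems(3)[of m] by auto
  next
    case False
    have c: "card (S - {m}) = n" using Suc.hyps(2) m Suc.prems(1) by simp
    have "S - {m} \<noteq> {}" using False m by blast
    then have "n \<noteq> 0" using c Suc.prems(1) by (metis card_0_eq finite_Diff)
    have gap: "f i + \<Delta> \<le> f m" if "i \<in> S - {m}" for i
      using Suc.prems(4)[of m i] m that by force
    \<comment> \<open>Hence the subtraction in \<open>f m - \<Delta>\<close> is not
      truncated.\<close>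
    from gap have ge: "f m \<ge> \<Delta>" using \<open>S - {m} \<noteq> {}\<close> by fastforce
    have "x + (card (S - {m}) - 1) * \<Delta> \<le> f m - \<Delta>"
    proof (rule Suc.hyps(1))
      show "x \<le> f i \<and> f i \<le> f m - \<Delta>" if "i \<in> S - {m}" for i
        using gap[OF that] Suc.prems(3)[of i] that by auto
    qed (use c Suc.prems \<open>S - {m} \<noteq> {}\<close> in auto)
    then have "x + (n - 1) * \<Delta> + \<Delta> \<le> f m" using c ge by simp
    moreover have "(n - 1) * \<Delta> + \<Delta> = n * \<Delta>" using \<open>n \<noteq> 0\<close> by (cases n) auto
    moreover have "f m \<le> y" using Suc.prems(3) m by blast
    ultimately show ?thesis using Suc.hyps(2) by (metis diff_Suc_1 add.assoc le_trans)
  qed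
qed

text \<open>\<open>Through i j\<close>: train \<open>i\<close> links the \<open>j\<close>-th arc of its path to the next one. \<open>Skip e \<theta>\<close>: the two
  ends of the arc \<open>e\<close> are linked with each other.\<close>

datatype 'a link = Through nat nat | Skip 'a nat

section \<open>Feasible train routings and the links offered to the matching\<close>

locale train_routing =
  fixes A :: "'a set" and src trg :: "'a \<Rightarrow> 'v" and s t :: 'v and \<tau> :: "'a \<Rightarrow> nat"
    and d \<Delta> :: nat and Ps :: "nat \<Rightarrow> 'a list" and lam :: "nat \<Rightarrow> 'a \<Rightarrow> nat" and T :: nat
  assumes feasible: "feasible_train_routing A src trg s t \<tau> d \<Delta> Ps lam"
    and headway_pos: "\<Delta> \<ge> 1"
    and horizon: "\<And>i a. \<lbrakk>i < d; a \<in> set (Ps i)\<rbrakk> \<Longrightarrow> lam i a + \<tau> a \<le> T"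
begin

lemma st_path: "i < d \<Longrightarrow> is_st_path A src trg s t (Ps i)"
  using feasible by (simp add: feasible_train_routing_def)

lemma distinct_vertices: "i < d \<Longrightarrow> distinct (s # map trg (Ps i))"
  using st_path by (auto simp: is_st_path_def)

lemma distinct_arcs: "i < d \<Longrightarrow> distinct (Ps i)"
  using distinct_vertices by (auto simp: distinct_map)

lemma linked: "\<lbrakk>i < d; Suc j < length (Ps i)\<rbrakk> \<Longrightarrow> trg (Ps i ! j) = src (Ps i ! Suc j)"
  using st_path by (auto simp: is_st_path_def)

text \<open>A simple path never returns to \<open>s\<close>; likewise it does not pass
  \<open>t\<close> before its end. So the restrictions on skip times at \<open>s\<close> and
  \<open>t\<close> do not affect an arc with train links on both sides.\<close>

lemma inner_src_neq:
  assumes "i < d" "Suc j < length (Ps i)"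
  shows "src (Ps i ! Suc j) \<noteq> s"
proof -
  have "trg (Ps i ! j) \<noteq> s" using distinct_vertices[OF assms(1)] assms(2) by auto
  then show ?thesis using linked assms by simp
qed

lemma inner_trg_neq:
  assumes "i < d" "Suc j < length (Ps i)"
  shows "trg (Ps i ! j) \<noteq> t"
proof -
  have "t = map trg (Ps i) ! (length (Ps i) - 1)"
    using st_path[OF assms(1)] by (auto simp: is_st_path_def last_conv_nth)
  moreover have "map trg (Ps i) ! j \<noteq> map trg (Ps i) ! (length (Ps i) - 1)"
    using distinct_vertices[OF assms(1)] assms(2) by (subst nth_eq_iff_index_eq) auto
  ultimately show ?thesis using assms(2) by simp
qed

lemma travel: "\<lbrakk>i < d; Suc j < length (Ps i)\<rbrakk>
    \<Longrightarrow> lam i (Ps i ! j) + \<tau> (Ps i ! j) \<le> lam i (Ps i ! Suc j)"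
  using feasible by (simp add: feasible_train_routing_def)

lemma headway: "\<lbrakk>i < d; i' < d; i \<noteq> i'; a \<in> set (Ps i); a \<in> set (Ps i')\<rbrakk>
    \<Longrightarrow> \<bar>int (lam i a) - int (lam i' a)\<bar> \<ge> int \<Delta>"
  using feasible by (simp add: feasible_train_routing_def)

lemma same_time: "\<lbrakk>i < d; i' < d; a \<in> set (Ps i); a \<in> set (Ps i'); lam i a = lam i' a\<rbrakk> \<Longrightarrow> i = i'"
  using headway[of i i' a] headway_pos by force

definition used :: "'a set" where
  "used = (\<Union>i<d. set (Ps i))"

lemma used_nth: "\<lbrakk>i < d; j < length (Ps i)\<rbrakk> \<Longrightarrow> Ps i ! j \<in> used"
  unfolding used_def using nth_mem by blast

lemma used_subset: "used \<subseteq> A"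
  using st_path by (force simp: used_def is_st_path_def)

primrec up :: "'a link \<Rightarrow> 'a" where
  "up (Through i j) = Ps i ! j"
| "up (Skip e \<theta>) = e"

primrec down :: "'a link \<Rightarrow> 'a" where
  "down (Through i j) = Ps i ! Suc j"
| "down (Skip e \<theta>) = e"

text \<open>The upstream end of a link prefers high ranks, the downstream end low ones. The parity makes a
  skip lie strictly between trains: compared with a train entering at the same time it is better for
  the downstream end and worse for the upstream end.\<close>

primrec up_rank :: "'a link \<Rightarrow> nat" where
  "up_rank (Through i j) = 2 * lam i (Ps i ! j) + 1"
| "up_rank (Skip e \<theta>) = 2 * \<theta>"

primrec down_rank :: "'a link \<Rightarrow> nat" where
  "down_rank (Through i j) = 2 * lam i (Ps i ! Suc j) + 1"
| "down_rank (Skip e \<theta>) = 2 * \<theta>"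

text \<open>The skips at times 0 and \<open>Suc T\<close> are the first choice of one end of the arc, which forces the
  other end to be matched; at s and t only the harmless one of them is admitted, so that an arc in
  use there may stay unmatched on that side.\<close>

definition links :: "'a link set" where
  "links = {Through i j | i j. i < d \<and> Suc j < length (Ps i)} \<union>
     {Skip e \<theta> | e \<theta>. e \<in> used \<and> \<theta> \<le> Suc T \<and> (src e = s \<longrightarrow> \<theta> = 0) \<and> (trg e = t \<longrightarrow> \<theta> = Suc T)}"

lemma Through_in_links [simp]: "Through i j \<in> links \<longleftrightarrow> i < d \<and> Suc j < length (Ps i)"
  by (auto simp: links_def)

lemma Skip_in_links [simp]:
  "Skip e \<theta> \<in> links \<longleftrightarrow>
    e \<in> used \<and> \<theta> \<le> Suc T \<and> (src e = s \<longrightarrow> \<theta> = 0) \<and> (trg e = t \<longrightarrow> \<theta> = Suc T)"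
  by (auto simp: links_def)

lemma finite_links: "finite links"
proof (rule finite_subset)
  show "links \<subseteq> (\<Union>i<d. Through i ` {..<length (Ps i)}) \<union> (\<Union>e\<in>used. Skip e ` {..Suc T})"
    by (auto simp: links_def)
  show "finite ((\<Union>i<d. Through i ` {..<length (Ps i)}) \<union> (\<Union>e\<in>used. Skip e ` {..Suc T}))"
    by (auto simp: used_def)
qed

text \<open>Preferences are strict: headways separate different trains on an arc, distinctness of
  arcs separates positions on one path, and parity separates skips from train links.\<close>

lemma up_rank_inj:
  assumes "m \<in> links" "m' \<in> links" "up m = up m'" "up_rank m = up_rank m'"
  shows "m = m'"
proof (cases m; cases m')
  fix i j i' j' assume eq: "m = Through i j" "m' = Through i' j'"
  then have "i = i'" using assms by (auto intro!: same_time[of i i' "Ps i ! j"] simp: in_set_conv_nth)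
    (metis Suc_lessD)+
  then show ?thesis using eq assms distinct_arcs by (auto simp: nth_eq_iff_index_eq)
qed (use assms in \<open>auto, presburger+\<close>)

lemma down_rank_inj:
  assumes "m \<in> links" "m' \<in> links" "down m = down m'" "down_rank m = down_rank m'"
  shows "m = m'"
proof (cases m; cases m')
  fix i j i' j' assume eq: "m = Through i j" "m' = Through i' j'"
  then have "i = i'" using assms by (auto intro!: same_time[of i i' "Ps i ! Suc j"] simp: in_set_conv_nth)
  then show ?thesis using eq assms distinct_arcs by (auto simp: nth_eq_iff_index_eq)
qed (use assms in \<open>auto, presburger+\<close>)

end

section \<open>Arcs left in use by a stable matching of links\<close>

locale stable_train_routing = train_routing +
  fixes M :: "'a link set"
  assumes M_links: "M \<subseteq> links" and up_inj: "inj_on up M" and down_inj: "inj_on down M"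
    and stable: "\<And>e. e \<in> links \<Longrightarrow> (\<exists>m\<in>M. up m = up e \<and> up_rank e \<le> up_rank m) \<or>
      (\<exists>m\<in>M. down m = down e \<and> down_rank m \<le> down_rank e)"
begin

definition skipped :: "'a set" where
  "skipped = {e. \<exists>\<theta>. Skip e \<theta> \<in> M}"

lemma M_Through: "Through i j \<in> M \<Longrightarrow> i < d \<and> Suc j < length (Ps i)"
  using M_links Through_in_links by blast

lemma M_Skip: "Skip e \<theta> \<in> M \<Longrightarrow>
    e \<in> used \<and> \<theta> \<le> Suc T \<and> (src e = s \<longrightarrow> \<theta> = 0) \<and> (trg e = t \<longrightarrow> \<theta> = Suc T)"
  using M_links Skip_in_links by blast

lemma up_eqD: "\<lbrakk>m \<in> M; m' \<in> M; up m = up m'\<rbrakk> \<Longrightarrow> m = m'"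
  using up_inj by (auto dest: inj_onD)

lemma down_eqD: "\<lbrakk>m \<in> M; m' \<in> M; down m = down m'\<rbrakk> \<Longrightarrow> m = m'"
  using down_inj by (auto dest: inj_onD)

text \<open>A skip occupies both ends of its arc, and each end carries at most one link of
  \<open>M\<close>.\<close>

lemma Through_not_skipped:
  assumes "Through i j \<in> M"
  shows "Ps i ! j \<notin> skipped" "Ps i ! Suc j \<notin> skipped"
  using up_eqD[OF assms] down_eqD[OF assms] by (force simp: skipped_def)+

lemma lam_le: "\<lbrakk>i < d; j < length (Ps i)\<rbrakk> \<Longrightarrow> lam i (Ps i ! j) \<le> T"
  using horizon[of i "Ps i ! j"] by auto

text \<open>At the end of \<open>e\<close> where it is the \<open>up\<close> arc, the skip at time
  \<open>Suc T\<close> outranks every train link, because no train enters after \<open>T\<close>. As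
  \<open>e\<close> is not skipped, stability must be settled where \<open>e\<close> is the
  \<open>down\<close> arc, so a train link is matched there.\<close>

lemma ex_incoming:
  assumes "e \<in> used" "e \<notin> skipped" "src e \<noteq> s"
  obtains i j where "Through i j \<in> M" "Ps i ! Suc j = e"
proof -
  have "Skip e (Suc T) \<in> links" using assms by simp
  from stable[OF this] consider
    m where "m \<in> M" "up m = e" "2 * Suc T \<le> up_rank m" | m where "m \<in> M" "down m = e"
    by auto
  then show thesis
  proof cases
    case 1
    then obtain i j where "Through i j \<in> M" "T < lam i (Ps i ! j)"
      using assms(2) by (cases m) (auto simp: skipped_def)
    then show thesis using lam_le[of i j] M_Through[of i j] by simp
  next
    case 2
    then show thesis using assms(2) that by (cases m) (auto simp: skipped_def)
  qed
qed

text \<open>Mirror image of \<open>ex_incoming\<close> with the skip at time \<open>0\<close>: its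
  rank \<open>0\<close> beats the odd rank of every train link having \<open>e\<close> as
  \<open>down\<close> arc.\<close>

lemma ex_outgoing:
  assumes "e \<in> used" "e \<notin> skipped" "trg e \<noteq> t"
  obtains i j where "Through i j \<in> M" "Ps i ! j = e"
proof -
  have "Skip e 0 \<in> links" using assms by simp
  from stable[OF this] consider
    m where "m \<in> M" "up m = e" | m where "m \<in> M" "down m = e" "down_rank m = 0"
    by auto
  then show thesis
  proof cases
    case 1
    then show thesis using assms(2) that by (cases m) (auto simp: skipped_def)
  next
    case 2
    then show thesis using assms(2) by (cases m) (auto simp: skipped_def)
  qed
qed

text \<open>Stability is tested on the skip of \<open>e\<close> at time \<open>lam i e\<close>. Its
  even rank is just below the odd rank of train \<open>i\<close>, so the incoming link cannot settle
  it; the outgoing one must, which bounds its time from below.\<close>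

lemma in_before_out:
  assumes "Through i j \<in> M" "Ps i ! Suc j = e" "Through i' j' \<in> M" "Ps i' ! j' = e"
  shows "lam i e \<le> lam i' e"
proof -
  have b: "i < d" "Suc j < length (Ps i)" "i' < d" "Suc j' < length (Ps i')"
    using assms M_Through by auto
  have "src e \<noteq> s" using inner_src_neq[of i j] b assms by simp
  moreover have "trg e \<noteq> t" using inner_trg_neq[of i' j'] b assms by simp
  moreover have "e \<in> used" "lam i e \<le> T"
    using b assms lam_le[of i "Suc j"] used_nth[of i "Suc j"] by auto
  ultimately have "Skip e (lam i e) \<in> links" by simp
  from stable[OF this] show ?thesis
  proof
    assume "\<exists>m\<in>M. up m = up (Skip e (lam i e)) \<and> up_rank (Skip e (lam i e)) \<le> up_rank m"
    then obtain m where "m \<in> M" "up m = e" "2 * lam i e \<le> up_rank m" by auto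
    moreover from this have "m = Through i' j'" using assms up_eqD by auto
    ultimately show ?thesis using assms by simp
  next
    assume "\<exists>m\<in>M. down m = down (Skip e (lam i e)) \<and> down_rank m \<le> down_rank (Skip e (lam i e))"
    then obtain m where "m \<in> M" "down m = e" "down_rank m \<le> 2 * lam i e" by auto
    moreover from this have "m = Through i j" using assms down_eqD by auto
    ultimately show ?thesis using assms by simp
  qed
qed

text \<open>A side of \<open>e\<close> without a matched train link imposes no condition. For an
  unskipped arc in use this happens only at \<open>s\<close> or \<open>t\<close>.\<close>

definition serves :: "'a \<Rightarrow> nat \<Rightarrow> bool" where
  "serves e i \<longleftrightarrow> e \<in> set (Ps i) \<and> e \<notin> skipped \<and>
    (\<forall>i' j'. Through i' j' \<in> M \<and> Ps i' ! Suc j' = e \<longrightarrow> lam i' e \<le> lam i e) \<and>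
    (\<forall>i' j'. Through i' j' \<in> M \<and> Ps i' ! j' = e \<longrightarrow> lam i e \<le> lam i' e)"

text \<open>The first arc of a train path is fine on its incoming side, the last one on its outgoing side, and
  at each junction stability settles one of the two adjacent sides; so some arc is fine on both.\<close>

lemma ex_serves:
  assumes "i < d"
  obtains e where "serves e i"
proof -
  define P where "P = Ps i"
  \<comment> \<open>\<open>2 * lam i e + 1\<close> is the rank of train \<open>i\<close> at
    \<open>e\<close>. \<open>bw\<close> says that \<open>e\<close> starts at \<open>s\<close> or
    that its incoming side is matched at least as well as by train \<open>i\<close>;
    \<open>fw\<close> is the analogue for \<open>t\<close> and the outgoing side.\<close>
  define bw where "bw e \<longleftrightarrow> src e = s \<or> (\<exists>m\<in>M. down m = e \<and> down_rank m \<le> 2 * lam i e + 1)" for e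
  define fw where "fw e \<longleftrightarrow> trg e = t \<or> (\<exists>m\<in>M. up m = e \<and> 2 * lam i e + 1 \<le> up_rank m)" for e
  have P: "P \<noteq> []" "src (hd P) = s" "trg (last P) = t"
    using st_path[OF assms] by (auto simp: is_st_path_def P_def)
  have step: "fw (P ! j) \<or> bw (P ! Suc j)" if "Suc j < length P" for j
  proof -
    have "Through i j \<in> links" using that assms P_def by simp
    from stable[OF this] show ?thesis by (auto simp: fw_def bw_def P_def)
  qed
  \<comment> \<open>The arc before the first one with \<open>fw\<close> violates \<open>fw\<close>,
    so \<open>step\<close> yields \<open>bw\<close> for the first one.\<close>
  define n where "n = (LEAST n. n < length P \<and> fw (P ! n))"
  have "length P - 1 < length P \<and> fw (P ! (length P - 1))"
    using P by (auto simp: fw_def last_conv_nth)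
  then have n: "n < length P" "fw (P ! n)" "\<And>k. \<lbrakk>k < n; k < length P\<rbrakk> \<Longrightarrow> \<not> fw (P ! k)"
    unfolding n_def by (metis (no_types, lifting) LeastI not_less_Least)+
  have "bw (P ! n)"
  proof (cases n)
    case 0
    then show ?thesis using P by (auto simp: bw_def hd_conv_nth)
  next
    case (Suc k)
    then show ?thesis using step[of k] n by auto
  qed
  define e where "e = P ! n"
  have e: "e \<in> set (Ps i)" "fw e" "bw e" using n \<open>bw (P ! n)\<close> by (auto simp: e_def P_def)
  have le: "lam i e \<le> T" using horizon[OF assms e(1)] by simp
  \<comment> \<open>The time of a skip of \<open>e\<close> in \<open>M\<close> would be both at most
    \<open>lam i e\<close> and above it; at \<open>s\<close> and \<open>t\<close> the prescribed
    times \<open>0\<close> and \<open>Suc T\<close> supply the respective bound.\<close>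
  have "e \<notin> skipped"
  proof
    assume "e \<in> skipped"
    then obtain \<theta> where sk: "Skip e \<theta> \<in> M" by (auto simp: skipped_def)
    have "src e = s \<or> 2 * \<theta> \<le> 2 * lam i e + 1"
      using e(3) down_eqD[OF sk] unfolding bw_def by (metis down.simps(2) down_rank.simps(2))
    moreover have "trg e = t \<or> 2 * lam i e + 1 \<le> 2 * \<theta>"
      using e(2) up_eqD[OF sk] unfolding fw_def by (metis up.simps(2) up_rank.simps(2))
    ultimately show False using M_Skip[OF sk] le by auto presburger
  qed
  moreover have "lam i' e \<le> lam i e" if "Through i' j' \<in> M" "Ps i' ! Suc j' = e" for i' j'
    using e(3) down_eqD[OF that(1)] that inner_src_neq M_Through[OF that(1)]
    by (force simp: bw_def)
  moreover have "lam i e \<le> lam i' e" if "Through i' j' \<in> M" "Ps i' ! j' = e" for i' j'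
    using e(2) up_eqD[OF that(1)] that inner_trg_neq M_Through[OF that(1)]
    by (force simp: fw_def)
  ultimately have "serves e i" using e by (auto simp: serves_def)
  then show thesis by (rule that)
qed

section \<open>Chains of arcs joined by matched train links\<close>

definition succ :: "('a \<times> 'a) set" where
  "succ = {(Ps i ! j, Ps i ! Suc j) | i j. Through i j \<in> M}"

lemma succI: "Through i j \<in> M \<Longrightarrow> (Ps i ! j, Ps i ! Suc j) \<in> succ"
  by (auto simp: succ_def)

text \<open>Each arc is the \<open>up\<close> arc of at most one link in \<open>M\<close>. With the
  same fact for \<open>down\<close>, the relation is a partial injection, so its components are
  chains or cycles.\<close>

lemma single_valued_succ: "single_valued succ"
  unfolding single_valued_def succ_def using up_eqD by fastforce

lemma single_valued_converse_succ: "single_valued (succ\<inverse>)"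
  unfolding single_valued_def succ_def using down_eqD by fastforce

lemma succ_used: "(e, f) \<in> succ \<Longrightarrow> e \<in> used - skipped \<and> f \<in> used - skipped"
  using Through_not_skipped M_Through used_nth by (fastforce simp: succ_def)

lemma succ_linked: "(e, f) \<in> succ \<Longrightarrow> trg e = src f"
  using M_Through linked by (auto simp: succ_def)

lemma finite_succ: "finite succ"
proof (rule finite_subset)
  show "succ \<subseteq> used \<times> used" using succ_used by auto
  show "finite (used \<times> used)" by (simp add: used_def)
qed

text \<open>Travel times may vanish, so time alone does not rule out cycles; ties are broken by the
  position of the arc on the train path.\<close>
lemma wf_succ: "wf succ"
proof -
  \<comment> \<open>The rank of \<open>e\<close> is the entry time of the train linking into it,
    followed by the position of \<open>e\<close> on that train's path. The default
    \<open>(0, 0)\<close> lies below all these pairs, since such positions are at least 1.\<close>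
  define rk where "rk e = (if \<exists>m\<in>M. \<exists>i j. m = Through i j \<and> Ps i ! Suc j = e
    then (case (THE m. m \<in> M \<and> down m = e) of Through i j \<Rightarrow> (lam i e, Suc j) | _ \<Rightarrow> (0, 0)) else (0, 0))" for e
  have rk: "rk (Ps i ! Suc j) = (lam i (Ps i ! Suc j), Suc j)" if "Through i j \<in> M" for i j
  proof -
    have "(THE m. m \<in> M \<and> down m = Ps i ! Suc j) = Through i j"
      using that down_eqD by (intro the_equality) auto
    then show ?thesis using that by (auto simp: rk_def)
  qed
  have "(rk e, rk f) \<in> less_than <*lex*> less_than" if ef: "(e, f) \<in> succ" for e f
  proof -
    obtain i j where m: "Through i j \<in> M" "e = Ps i ! j" "f = Ps i ! Suc j"
      using ef unfolding succ_def by blast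
    have b: "i < d" "Suc j < length (Ps i)" using m M_Through by auto
    have le: "lam i e \<le> lam i f" using travel b m by fastforce
    show ?thesis
    proof (cases "\<exists>i' j'. Through i' j' \<in> M \<and> Ps i' ! Suc j' = e")
      case False
      then have "rk e = (0, 0)" by (auto simp: rk_def)
      then show ?thesis using rk m by auto
    next
      case True
      then obtain i' j' where m': "Through i' j' \<in> M" "Ps i' ! Suc j' = e" by auto
      have b': "i' < d" "Suc j' < length (Ps i')" using m' M_Through by auto
      have r: "rk e = (lam i' e, Suc j')" "rk f = (lam i f, Suc j)"
        using rk[OF m(1)] rk[OF m'(1)] m(3) m'(2) by simp_all
      have le': "lam i' e \<le> lam i e" using in_before_out m m' by auto
      show ?thesis
      proof (cases "lam i' e < lam i f")
        case True
        then show ?thesis using r by auto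
      next
        case False
        \<comment> \<open>Without progress in time both links belong to trains entering
          \<open>e\<close> simultaneously, hence to the same train, and the position
          increases.\<close>
        then have "lam i' e = lam i e" using le le' by simp
        moreover have "e \<in> set (Ps i)" "e \<in> set (Ps i')"
          using nth_mem[of j "Ps i"] nth_mem[of "Suc j'" "Ps i'"] b b' m m' by auto
        ultimately have "i' = i" using same_time b b' by blast
        then have "Suc j' = j" using m m' b b' distinct_arcs[OF b(1)]
          by (auto simp: nth_eq_iff_index_eq)
        then show ?thesis using r False le le' by auto
      qed
    qed
  qed
  then have "succ \<subseteq> inv_image (less_than <*lex*> less_than) rk" by auto
  then show ?thesis by (rule wf_subset[rotated]) auto
qed

lemma wf_converse_succ: "wf (succ\<inverse>)"
  using finite_acyclic_wf_converse[OF finite_succ wf_acyclic[OF wf_succ]] .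

text \<open>Here \<open>c i\<close> is the arc to which train \<open>i\<close> is charged, and the
  anchor \<open>p\<close> enters \<open>e\<close> no later than the trains charged to
  \<open>e\<close> and the train linking out of \<open>e\<close>. Induction along the chain passes
  the anchor role to that linking train: headways on \<open>e\<close> pay for the trains charged to
  \<open>e\<close>, and its travel to the next arc pays for \<open>\<tau> e\<close>.\<close>

lemma served_card_bound:
  assumes "successively (\<lambda>e f. (e, f) \<in> succ) (e # W)" "last (e # W) \<notin> Domain succ"
    "set (e # W) \<subseteq> used - skipped"
    "p < d" "e \<in> set (Ps p)" "\<And>i. \<lbrakk>i \<in> S; c i = e\<rbrakk> \<Longrightarrow> lam p e \<le> lam i e"
    "\<And>i j. \<lbrakk>Through i j \<in> M; Ps i ! j = e\<rbrakk> \<Longrightarrow> lam p e \<le> lam i e"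
    "S \<subseteq> {..<d}" "\<And>i. i \<in> S \<Longrightarrow> c i \<in> set (e # W) \<and> serves (c i) i"
  shows "lam p e + path_time \<tau> (e # W) + (card (insert p S) - 1) * \<Delta> \<le> T"
  using assms
proof (induction W arbitrary: e p S)
  case Nil
  have S: "e \<in> set (Ps i) \<and> i < d \<and> lam p e \<le> lam i e" if "i \<in> S" for i
  proof -
    have "c i = e" "serves (c i) i" using Nil.prems(9)[OF that] by auto
    then show ?thesis using Nil.prems(6,8) that by (auto simp: serves_def)
  qed
  have "lam p e + (card (insert p S) - 1) * \<Delta> \<le> T - \<tau> e"
  proof (rule separated_card_bound)
    show "finite (insert p S)" using finite_subset[OF Nil.prems(8)] by simp
    show "lam p e \<le> lam i e \<and> lam i e \<le> T - \<tau> e" if "i \<in> insert p S" for i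
      using that S Nil horizon[of i e] by auto
    show "int \<Delta> \<le> \<bar>int (lam i e) - int (lam j e)\<bar>" if "i \<in> insert p S" "j \<in> insert p S" "i \<noteq> j" for i j
      using that S Nil headway[of i j e] by auto
  qed auto
  moreover have "\<tau> e \<le> T" using horizon[of p e] Nil by auto
  ultimately show ?case by (auto simp: path_time_def)
next
  case (Cons f W)
  have "(e, f) \<in> succ" using Cons.prems(1) by simp
  then obtain h j where h: "Through h j \<in> M" "e = Ps h ! j" "f = Ps h ! Suc j"
    unfolding succ_def by blast
  have b: "h < d" "Suc j < length (Ps h)" using h M_Through by auto
  then have hin: "e \<in> set (Ps h)" "f \<in> set (Ps h)" using h by auto
  \<comment> \<open>Trains charged to the first arc are counted there, all others on the rest of the
    chain.\<close>
  define S1 where "S1 = {i\<in>S. c i = e}"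
  define S2 where "S2 = {i\<in>S. c i \<noteq> e}"
  have fin: "finite S1" "finite S2" using Cons.prems(8) by (auto simp: S1_def S2_def intro: finite_subset)
  have S1: "e \<in> set (Ps i) \<and> i < d \<and> lam p e \<le> lam i e \<and> lam i e \<le> lam h e" if "i \<in> S1" for i
  proof -
    have "i \<in> S" "c i = e" using that by (auto simp: S1_def)
    moreover from this have "serves e i" using Cons.prems(9) by metis
    ultimately show ?thesis using Cons.prems(6,8) h by (auto simp: serves_def)
  qed
  have ph: "lam p e \<le> lam h e" using Cons.prems(7) h by blast
  have 1: "lam p e + (card (insert p (insert h S1)) - 1) * \<Delta> \<le> lam h e"
  proof (rule separated_card_bound)
    show "lam p e \<le> lam i e \<and> lam i e \<le> lam h e" if "i \<in> insert p (insert h S1)" for i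
      using that S1 ph by auto
    show "int \<Delta> \<le> \<bar>int (lam i e) - int (lam j e)\<bar>"
      if "i \<in> insert p (insert h S1)" "j \<in> insert p (insert h S1)" "i \<noteq> j" for i j
      using that S1 Cons.prems b hin headway[of i j e] by auto
  qed (use fin in auto)
  \<comment> \<open>Train \<open>h\<close> links into \<open>f\<close>, so the definition of
    \<open>serves\<close> and \<open>in_before_out\<close> make it an anchor at
    \<open>f\<close>.\<close>
  have 2: "lam h f + path_time \<tau> (f # W) + (card (insert h S2) - 1) * \<Delta> \<le> T"
  proof (rule Cons.IH)
    show "lam h f \<le> lam i f" if "i \<in> S2" "c i = f" for i
    proof -
      have "serves f i" using that Cons.prems(9)[of i] by (auto simp: S2_def)
      then show ?thesis using h by (auto simp: serves_def)
    qed
    show "lam h f \<le> lam i f" if "Through i j' \<in> M" "Ps i ! j' = f" for i j'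
      using in_before_out[of h j f i j'] that h by simp
    show "c i \<in> set (f # W) \<and> serves (c i) i" if "i \<in> S2" for i
      using that Cons.prems(9)[of i] by (auto simp: S2_def)
  qed (use Cons.prems(1-3,8) b hin in \<open>auto simp: S2_def\<close>)
  have 3: "lam h e + \<tau> e \<le> lam h f" using travel b h by auto
  have "insert p S \<subseteq> insert p (insert h S1) \<union> insert h S2" by (auto simp: S1_def S2_def)
  then have "card (insert p S) \<le> card (insert p (insert h S1) \<union> insert h S2)"
    using fin by (intro card_mono) auto
  \<comment> \<open>Train \<open>h\<close> is counted on both sides, which compensates for
    subtracting 1 twice.\<close>
  also have "\<dots> + 1 \<le> card (insert p (insert h S1)) + card (insert h S2)"
  proof -
    have "1 \<le> card (insert p (insert h S1) \<inter> insert h S2)"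
      using fin by (auto simp: Suc_le_eq card_gt_0_iff)
    then show ?thesis using card_Un_Int[of "insert p (insert h S1)" "insert h S2"] fin by simp
  qed
  finally have "card (insert p S) + 1 \<le> card (insert p (insert h S1)) + card (insert h S2)" by simp
  moreover have "1 \<le> card (insert p (insert h S1))" "1 \<le> card (insert h S2)" using fin by (auto simp: card_insert_if Suc_le_eq card_gt_0_iff)
  ultimately have "card (insert p S) - 1 \<le> (card (insert p (insert h S1)) - 1) + (card (insert h S2) - 1)" by linarith
  then have "(card (insert p S) - 1) * \<Delta> \<le> (card (insert p (insert h S1)) - 1) * \<Delta> + (card (insert h S2) - 1) * \<Delta>"
    by (metis add_mult_distrib mult_le_mono1)
  then show ?case using 1 2 3 by (simp add: path_time_def)
qed

end

section \<open>From chains to a convoy routing\<close>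

context stable_train_routing
begin

lemma ex_root:
  "\<exists>z. (z, e) \<in> succ\<^sup>* \<and> z \<notin> Range succ"
  using wf_succ
proof (induction e rule: wf_induct_rule)
  case (less e)
  show ?case
  proof (cases "e \<in> Range succ")
    case True
    then obtain e' where "(e', e) \<in> succ" by blast
    then show ?thesis using less by (meson rtrancl.rtrancl_into_rtrancl)
  qed auto
qed

text \<open>Tracing a chain backwards is deterministic, so one of the two roots is reached from the
  other; having no predecessors, they coincide.\<close>

lemma root_unique:
  assumes "(z, e) \<in> succ\<^sup>*" "z \<notin> Range succ" "(z', e) \<in> succ\<^sup>*" "z' \<notin> Range succ"
  shows "z = z'"
proof -
  have "(e, z) \<in> (succ\<inverse>)\<^sup>*" "(e, z') \<in> (succ\<inverse>)\<^sup>*"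
    using assms by (auto simp: rtrancl_converse)
  from single_valued_confluent[OF single_valued_converse_succ this]
  have "(z, z') \<in> succ\<^sup>* \<or> (z', z) \<in> succ\<^sup>*" by (auto simp: rtrancl_converse)
  then show ?thesis using assms by (metis Range.intros rtranclE)
qed

text \<open>Each train is charged to an arc serving it and thereby to the root of the chain of that
  arc. Only chains with a charged train are kept in \<open>Z\<close>, so every convoy is nonempty,
  and the sets \<open>F z\<close> partition the trains.\<close>

lemma ex_convoy_of_stable:
  assumes "s \<noteq> t" "d \<ge> 1"
  obtains k Q \<sigma> where "convoy_routing A src trg s t d k Q \<sigma>" "convoy_makespan \<tau> \<Delta> k Q \<sigma> \<le> T"
proof -
  have "\<forall>i. \<exists>e. i < d \<longrightarrow> serves e i" using ex_serves by blast
  then obtain c where c: "\<And>i. i < d \<Longrightarrow> serves (c i) i" by metis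
  obtain root where root: "\<And>e. (root e, e) \<in> succ\<^sup>*" "\<And>e. root e \<notin> Range succ"
    using ex_root by metis
  define Z where "Z = (\<lambda>i. root (c i)) ` {..<d}"
  have fin: "finite Z" by (simp add: Z_def)
  define F where "F z = {i. i < d \<and> root (c i) = z}" for z
  have Fne: "F z \<noteq> {}" "finite (F z)" if "z \<in> Z" for z using that by (auto simp: Z_def F_def)
  obtain W where W: "\<And>z. successively (\<lambda>e f. (e, f) \<in> succ) (z # W z)"
    "\<And>z. last (z # W z) \<notin> Domain succ" "\<And>z. set (z # W z) = succ\<^sup>* `` {z}"
    using forward_chain_exists[OF wf_converse_succ single_valued_succ] by metis
  have c_used: "c i \<in> used - skipped" if "i < d" for i
    using c[OF that] that by (auto simp: serves_def used_def)
  have root_used: "root (c i) \<in> used - skipped" if "i < d" for i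
    using root(1)[of "c i"] c_used[OF that] by (metis converse_rtranclE succ_used)
  have W_used: "set (z # W z) \<subseteq> used - skipped" if "z \<in> Z" for z
  proof
    fix e assume "e \<in> set (z # W z)"
    then have "(z, e) \<in> succ\<^sup>*" using W(3) by blast
    moreover have "z \<in> used - skipped" using root_used that by (auto simp: Z_def)
    ultimately show "e \<in> used - skipped" by (metis rtranclE succ_used)
  qed
  have ex_path: "\<exists>P. is_st_path A src trg s t P \<and> set P \<subseteq> succ\<^sup>* `` {z} \<and>
      path_time \<tau> P + (card (F z) - 1) * \<Delta> \<le> T" if z: "z \<in> Z" for z
  proof -
    have zu: "z \<in> used" "z \<notin> skipped" using W_used[OF z] by auto
    have nr: "z \<notin> Range succ" using z root by (auto simp: Z_def)
    have "src z = s"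
    proof (rule ccontr)
      assume "src z \<noteq> s"
      then obtain i j where "Through i j \<in> M" "Ps i ! Suc j = z" using ex_incoming zu by blast
      then show False using nr succI by blast
    qed
    have last_used: "last (z # W z) \<in> used" "last (z # W z) \<notin> skipped"
      using W_used[OF z] last_in_set[of "z # W z"] by blast+
    have "trg (last (z # W z)) = t"
    proof (rule ccontr)
      assume "trg (last (z # W z)) \<noteq> t"
      then obtain i j where "Through i j \<in> M" "Ps i ! j = last (z # W z)"
        using ex_outgoing last_used by blast
      then show False using W(2)[of z] succI by (metis Domain.intros)
    qed
    moreover have "successively (\<lambda>e f. trg e = src f) (z # W z)"
      using W(1)[of z] by (rule successively_mono) (auto dest: succ_linked)
    ultimately have "walk src trg s (z # W z) t"
      using \<open>src z = s\<close> by (subst walk_iff_successively) auto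
    then obtain P where P: "is_st_path A src trg s t P" "set P \<subseteq> set (z # W z)"
      "path_time \<tau> P \<le> path_time \<tau> (z # W z)"
    proof (rule walk_imp_st_path[where \<tau> = \<tau>])
      show "set (z # W z) \<subseteq> A" using W_used[OF z] used_subset by blast
    qed (use assms in blast)+
    \<comment> \<open>The earliest of all trains on the root is the anchor \<open>p\<close> that
      starts the count.\<close>
    define X where "X = {i. i < d \<and> z \<in> set (Ps i)}"
    have "finite X" "X \<noteq> {}" using zu by (auto simp: X_def used_def)
    then obtain p where p: "p \<in> X" "\<And>i. i \<in> X \<Longrightarrow> lam p z \<le> lam i z"
      using finite_ex_min[of X "\<lambda>i. lam i z"] by blast
    have "lam p z + path_time \<tau> (z # W z) + (card (insert p (F z)) - 1) * \<Delta> \<le> T"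
    proof (rule served_card_bound)
      show "successively (\<lambda>e f. (e, f) \<in> succ) (z # W z)" by (rule W)
      show "last (z # W z) \<notin> Domain succ" by (rule W)
      show "set (z # W z) \<subseteq> used - skipped" using W_used z by blast
      show "p < d" "z \<in> set (Ps p)" using p by (auto simp: X_def)
      show "lam p z \<le> lam i z" if "i \<in> F z" "c i = z" for i
        using that p(2)[of i] c[of i] by (auto simp: X_def F_def serves_def)
      show "lam p z \<le> lam i z" if "Through i j \<in> M" "Ps i ! j = z" for i j
        using that p(2)[of i] M_Through[OF that(1)] nth_mem[of j "Ps i"] by (auto simp: X_def)
      show "F z \<subseteq> {..<d}" by (auto simp: F_def)
      show "c i \<in> set (z # W z) \<and> serves (c i) i" if "i \<in> F z" for i
        using that c root(1)[of "c i"] unfolding W(3) by (auto simp: F_def)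
    qed
    \<comment> \<open>Train \<open>p\<close> may be charged to another chain; leaving it out of the
      count only lowers the left-hand side.\<close>
    moreover have "card (F z) \<le> card (insert p (F z))"
      using Fne[OF z] by (auto intro: card_mono)
    then have "(card (F z) - 1) * \<Delta> \<le> (card (insert p (F z)) - 1) * \<Delta>"
      by (intro mult_le_mono1) simp
    ultimately have "path_time \<tau> P + (card (F z) - 1) * \<Delta> \<le> T" using P(3) by linarith
    then show ?thesis using P W(3) by blast
  qed
  then obtain P where P: "\<And>z. z \<in> Z \<Longrightarrow> is_st_path A src trg s t (P z)"
    "\<And>z. z \<in> Z \<Longrightarrow> set (P z) \<subseteq> succ\<^sup>* `` {z}"
    "\<And>z. z \<in> Z \<Longrightarrow> path_time \<tau> (P z) + (card (F z) - 1) * \<Delta> \<le> T"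
    by metis
  obtain g where g: "bij_betw g {..<card Z} Z"
    using ex_bij_betw_nat_finite[OF fin] by (auto simp: atLeast0LessThan)
  have gZ: "g i \<in> Z" if "i < card Z" for i using g that by (auto simp: bij_betw_def)
  \<comment> \<open>A common arc would have both \<open>z\<close> and \<open>z'\<close> as root.
    Shortening to simple paths keeps the arcs within their chains.\<close>
  have disj: "set (P z) \<inter> set (P z') = {}" if "z \<in> Z" "z' \<in> Z" "z \<noteq> z'" for z z'
    using P(2)[OF that(1)] P(2)[OF that(2)] that root(2) root_unique unfolding Z_def by blast
  have "Z \<noteq> {}" using assms(2) by (auto simp: Z_def lessThan_empty_iff)
  show thesis
  proof (rule that)
    show "convoy_routing A src trg s t d (card Z) (P \<circ> g) (\<lambda>i. card (F (g i)))"
      unfolding convoy_routing_def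
    proof (intro conjI allI impI)
      show "card Z \<le> d" using card_image_le[of "{..<d}"] by (simp add: Z_def)
      show "is_st_path A src trg s t ((P \<circ> g) i)" if "i < card Z" for i
        using P gZ that by simp
      show "set ((P \<circ> g) i) \<inter> set ((P \<circ> g) i') = {}" if "i < card Z" "i' < card Z" "i \<noteq> i'" for i i'
        using disj[OF gZ gZ] that g by (auto simp: bij_betw_def inj_on_def)
      show "1 \<le> card (F (g i))" if "i < card Z" for i
        using Fne[OF gZ[OF that]] by (simp add: Suc_le_eq card_gt_0_iff)
      have "(\<Sum>i<card Z. card (F (g i))) = (\<Sum>z\<in>Z. card (F z))"
        by (rule sum.reindex_bij_betw[OF g])
      also have "\<dots> = card (\<Union>z\<in>Z. F z)"
        using fin by (intro card_UN_disjoint[symmetric]) (auto simp: F_def)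
      also have "(\<Union>z\<in>Z. F z) = {..<d}" by (auto simp: F_def Z_def)
      finally show "(\<Sum>i<card Z. card (F (g i))) = d" by simp
    qed
    have "{path_time \<tau> ((P \<circ> g) i) + (card (F (g i)) - 1) * \<Delta> |i. i < card Z} \<noteq> {}"
      using \<open>Z \<noteq> {}\<close> fin card_gt_0_iff[of Z] by blast
    then show "convoy_makespan \<tau> \<Delta> (card Z) (P \<circ> g) (\<lambda>i. card (F (g i))) \<le> T"
      unfolding convoy_makespan_def using P(3) gZ by (subst Max_le_iff) auto
  qed
qed

end

lemma (in train_routing) ex_convoy:
  assumes "s \<noteq> t" "d \<ge> 1"
  obtains k Q \<sigma> where "convoy_routing A src trg s t d k Q \<sigma>" "convoy_makespan \<tau> \<Delta> k Q \<sigma> \<le> T"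
proof -
  obtain M where "M \<subseteq> links" "inj_on up M" "inj_on down M"
    "\<And>e. e \<in> links \<Longrightarrow> (\<exists>m\<in>M. up m = up e \<and> up_rank e \<le> up_rank m) \<or>
      (\<exists>m\<in>M. down m = down e \<and> down_rank m \<le> down_rank e)"
    by (rule stable_matching_exists[of links up up_rank down down_rank,
          OF finite_links up_rank_inj down_rank_inj]) blast+
  then interpret stable_train_routing A src trg s t \<tau> d \<Delta> Ps lam T M
    by unfold_locales
  show thesis using ex_convoy_of_stable[OF assms] that by blast
qed

section \<open>The train routing induced by a convoy routing\<close>

lemma conv_idx_sum_add:
  assumes "p < \<sigma> i"
  shows "conv_idx \<sigma> ((\<Sum>l<i. \<sigma> l) + p) = i" "conv_pos \<sigma> ((\<Sum>l<i. \<sigma> l) + p) = p"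
proof -
  show "conv_idx \<sigma> ((\<Sum>l<i. \<sigma> l) + p) = i"
    unfolding conv_idx_def
  proof (rule Least_equality)
    show "(\<Sum>l<i. \<sigma> l) + p < (\<Sum>l\<le>i. \<sigma> l)"
      using assms by (simp add: lessThan_Suc_atMost[symmetric])
    show "i \<le> m" if "(\<Sum>l<i. \<sigma> l) + p < (\<Sum>l\<le>m. \<sigma> l)" for m
    proof (rule ccontr)
      assume "\<not> i \<le> m"
      then have "(\<Sum>l\<le>m. \<sigma> l) \<le> (\<Sum>l<i. \<sigma> l)" by (intro sum_mono2) auto
      then show False using that by simp
    qed
  qed
  then show "conv_pos \<sigma> ((\<Sum>l<i. \<sigma> l) + p) = p" by (simp add: conv_pos_def)
qed

text \<open>Train numbers form consecutive blocks, one of size \<open>\<sigma> i\<close> per path,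
  so a number splits into the start of its block and a position inside it.\<close>

lemma conv_idx_cases:
  fixes \<sigma> :: "nat \<Rightarrow> nat"
  assumes "n < (\<Sum>l<k. \<sigma> l)"
  obtains i p where "i < k" "p < \<sigma> i" "n = (\<Sum>l<i. \<sigma> l) + p"
proof -
  have "\<exists>i p. i < k \<and> p < \<sigma> i \<and> n = (\<Sum>l<i. \<sigma> l) + p"
    using assms
  proof (induction k)
    case (Suc k)
    show ?case
    proof (cases "n < (\<Sum>l<k. \<sigma> l)")
      case True
      then show ?thesis using Suc.IH less_SucI by blast
    next
      case False
      then show ?thesis using Suc.prems
        by (intro exI[of _ k] exI[of _ "n - (\<Sum>l<k. \<sigma> l)"]) auto
    qed
  qed simp
  then show thesis using that by blast
qed

lemma path_time_take_le: "path_time \<tau> (take j P) \<le> path_time \<tau> P"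
  by (subst append_take_drop_id[of j P, symmetric]) (simp add: path_time_def del: append_take_drop_id)

lemma takeWhile_neq_nth: "\<lbrakk>distinct P; j < length P\<rbrakk> \<Longrightarrow> takeWhile (\<lambda>b. b \<noteq> P ! j) P = take j P"
  by (rule takeWhile_eq_take_P_nth) (auto simp: nth_eq_iff_index_eq)

lemma convoy_index:
  assumes "convoy_routing A src trg s t d k Q \<sigma>" "n < d"
  shows "conv_idx \<sigma> n < k" "conv_pos \<sigma> n < \<sigma> (conv_idx \<sigma> n)"
    "n = (\<Sum>l<conv_idx \<sigma> n. \<sigma> l) + conv_pos \<sigma> n"
proof -
  have "n < (\<Sum>l<k. \<sigma> l)" using assms by (simp add: convoy_routing_def)
  then obtain i p where ip: "i < k" "p < \<sigma> i" "n = (\<Sum>l<i. \<sigma> l) + p"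
    by (rule conv_idx_cases)
  then have "conv_idx \<sigma> n = i" "conv_pos \<sigma> n = p" using conv_idx_sum_add by blast+
  then show "conv_idx \<sigma> n < k" "conv_pos \<sigma> n < \<sigma> (conv_idx \<sigma> n)"
    "n = (\<Sum>l<conv_idx \<sigma> n. \<sigma> l) + conv_pos \<sigma> n" using ip by auto
qed

lemma st_path_distinct: "is_st_path A src trg s t P \<Longrightarrow> distinct P"
  by (auto simp: is_st_path_def distinct_map)

lemma induced_entry_nth:
  assumes "convoy_routing A src trg s t d k Q \<sigma>" "n < d" "j < length (induced_paths Q \<sigma> n)"
  shows "induced_entry \<tau> \<Delta> Q \<sigma> n (induced_paths Q \<sigma> n ! j) =
    conv_pos \<sigma> n * \<Delta> + path_time \<tau> (take j (induced_paths Q \<sigma> n))"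
proof -
  have "is_st_path A src trg s t (Q (conv_idx \<sigma> n))"
    using assms(1) convoy_index(1)[OF assms(1,2)] by (simp add: convoy_routing_def)
  then show ?thesis using assms(3)
    by (simp add: induced_entry_def induced_paths_def takeWhile_neq_nth st_path_distinct)
qed

lemma path_time_take_Suc:
  "j < length P \<Longrightarrow> path_time \<tau> (take (Suc j) P) = path_time \<tau> (take j P) + \<tau> (P ! j)"
  by (simp add: path_time_def take_Suc_conv_app_nth)

text \<open>Trains on different paths share no arc. On one path the travel times cancel, so entry
  times differ by a nonzero multiple of \<open>\<Delta>\<close>; without waiting, the travel
  inequality is an equality.\<close>

lemma induced_feasible:
  assumes conv: "convoy_routing A src trg s t d k Q \<sigma>"
  shows "feasible_train_routing A src trg s t \<tau> d \<Delta> (induced_paths Q \<sigma>) (induced_entry \<tau> \<Delta> Q \<sigma>)"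
  unfolding feasible_train_routing_def
proof (intro conjI allI impI ballI)
  show "is_st_path A src trg s t (induced_paths Q \<sigma> i)" if "i < d" for i
    using conv convoy_index(1)[OF conv that] by (simp add: convoy_routing_def induced_paths_def)
  show "induced_entry \<tau> \<Delta> Q \<sigma> i (induced_paths Q \<sigma> i ! j) + \<tau> (induced_paths Q \<sigma> i ! j)
      \<le> induced_entry \<tau> \<Delta> Q \<sigma> i (induced_paths Q \<sigma> i ! Suc j)"
    if "i < d" "Suc j < length (induced_paths Q \<sigma> i)" for i j
    using that conv by (simp add: induced_entry_nth path_time_take_Suc)
  show "int \<Delta> \<le> \<bar>int (induced_entry \<tau> \<Delta> Q \<sigma> i a) - int (induced_entry \<tau> \<Delta> Q \<sigma> i' a)\<bar>"
    if "i < d" "i' < d" "i \<noteq> i'" "a \<in> set (induced_paths Q \<sigma> i) \<inter> set (induced_paths Q \<sigma> i')" for i i' a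
  proof -
    have "conv_idx \<sigma> i = conv_idx \<sigma> i'"
      using that conv convoy_index(1)[OF conv] unfolding convoy_routing_def induced_paths_def by blast
    moreover from this have "conv_pos \<sigma> i \<noteq> conv_pos \<sigma> i'"
      using convoy_index(3)[OF conv] that by metis
    ultimately have "\<bar>int (induced_entry \<tau> \<Delta> Q \<sigma> i a) - int (induced_entry \<tau> \<Delta> Q \<sigma> i' a)\<bar>
        = \<bar>int (conv_pos \<sigma> i) - int (conv_pos \<sigma> i')\<bar> * int \<Delta>"
      by (simp add: induced_entry_def abs_mult left_diff_distrib[symmetric])
    moreover have "1 \<le> \<bar>int (conv_pos \<sigma> i) - int (conv_pos \<sigma> i')\<bar>"
      using \<open>conv_pos \<sigma> i \<noteq> conv_pos \<sigma> i'\<close> by simp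
    ultimately show ?thesis by (simp add: mult_le_cancel_right1)
  qed
qed

lemma finite_train_times: "finite {lam i a + \<tau> a |i a. i < (d::nat) \<and> a \<in> set (Ps i)}"
proof (rule finite_subset)
  show "{lam i a + \<tau> a |i a. i < d \<and> a \<in> set (Ps i)} \<subseteq> (\<Union>i<d. (\<lambda>a. lam i a + \<tau> a) ` set (Ps i))"
    by auto
qed auto

text \<open>No train on a path leaves an arc later than the last train of that convoy reaches
  \<open>t\<close>, and that arrival time is the term of the path in the convoy makespan.\<close>

lemma induced_makespan:
  assumes conv: "convoy_routing A src trg s t d k Q \<sigma>" and "d \<ge> 1"
  shows "train_makespan \<tau> d (induced_paths Q \<sigma>) (induced_entry \<tau> \<Delta> Q \<sigma>) = convoy_makespan \<tau> \<Delta> k Q \<sigma>"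
proof (rule antisym)
  let ?tr = "{induced_entry \<tau> \<Delta> Q \<sigma> i a + \<tau> a |i a. i < d \<and> a \<in> set (induced_paths Q \<sigma> i)}"
  let ?co = "{path_time \<tau> (Q i) + (\<sigma> i - 1) * \<Delta> |i. i < k}"
  have kpos: "k > 0" using convoy_index(1)[OF conv, of 0] assms(2) by simp
  have path: "is_st_path A src trg s t (Q i)" if "i < k" for i
    using conv that by (simp add: convoy_routing_def)
  then have ne: "Q i \<noteq> []" if "i < k" for i using that by (auto simp: is_st_path_def)
  have tr_ne: "?tr \<noteq> {}"
    using ne[OF convoy_index(1)[OF conv, of 0]] assms(2) by (auto simp: induced_paths_def)
      (metis less_eq_Suc_le hd_in_set)
  show "train_makespan \<tau> d (induced_paths Q \<sigma>) (induced_entry \<tau> \<Delta> Q \<sigma>) \<le> convoy_makespan \<tau> \<Delta> k Q \<sigma>"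
    unfolding train_makespan_def
  proof (rule Max.boundedI[OF finite_train_times tr_ne])
    fix x assume "x \<in> ?tr"
    then obtain n a where n: "n < d" "a \<in> set (induced_paths Q \<sigma> n)"
      "x = induced_entry \<tau> \<Delta> Q \<sigma> n a + \<tau> a" by blast
    then obtain j where j: "j < length (induced_paths Q \<sigma> n)" "a = induced_paths Q \<sigma> n ! j"
      by (auto simp: in_set_conv_nth)
    define i where "i = conv_idx \<sigma> n"
    have "x = conv_pos \<sigma> n * \<Delta> + path_time \<tau> (take (Suc j) (Q i))"
      using n j conv induced_entry_nth[OF conv n(1) j(1)] by (simp add: path_time_take_Suc induced_paths_def i_def)
    also have "\<dots> \<le> (\<sigma> i - 1) * \<Delta> + path_time \<tau> (Q i)"
      using convoy_index(2)[OF conv n(1)] unfolding i_def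
      by (intro add_mono mult_le_mono1 path_time_take_le) simp
    also have "\<dots> \<le> convoy_makespan \<tau> \<Delta> k Q \<sigma>"
      unfolding convoy_makespan_def using convoy_index(1)[OF conv n(1)]
      by (intro Max_ge) (auto simp: i_def add.commute)
    finally show "x \<le> convoy_makespan \<tau> \<Delta> k Q \<sigma>" .
  qed
  show "convoy_makespan \<tau> \<Delta> k Q \<sigma> \<le> train_makespan \<tau> d (induced_paths Q \<sigma>) (induced_entry \<tau> \<Delta> Q \<sigma>)"
    unfolding convoy_makespan_def
  proof (rule Max.boundedI)
    show "?co \<noteq> {}" using kpos by auto
    fix x assume "x \<in> ?co"
    then obtain i where i: "i < k" "x = path_time \<tau> (Q i) + (\<sigma> i - 1) * \<Delta>" by blast
    \<comment> \<open>Positions start at 0, so this is the last train of the convoy on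
      \<open>Q i\<close>.\<close>
    define p where "p = \<sigma> i - 1"
    define n where "n = (\<Sum>l<i. \<sigma> l) + p"
    have p: "p < \<sigma> i" using conv i(1) by (auto simp: p_def convoy_routing_def Suc_le_eq)
    have ip: "conv_idx \<sigma> n = i" "conv_pos \<sigma> n = p"
      using conv_idx_sum_add[of p \<sigma> i] p by (auto simp: n_def)
    have "n < (\<Sum>l<Suc i. \<sigma> l)" using p by (simp add: n_def)
    also have "\<dots> \<le> (\<Sum>l<k. \<sigma> l)" using i(1) by (intro sum_mono2) auto
    finally have n: "n < d" using conv by (simp add: convoy_routing_def)
    define j where "j = length (Q i) - 1"
    have j: "j < length (induced_paths Q \<sigma> n)" "Suc j = length (Q i)"
      using ne[OF i(1)] by (auto simp: j_def induced_paths_def ip)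
    have "x = induced_entry \<tau> \<Delta> Q \<sigma> n (Q i ! j) + \<tau> (Q i ! j)"
      using induced_entry_nth[OF conv n j(1)] path_time_take_Suc[of j "Q i" \<tau>] j(2)
      by (simp add: i(2) induced_paths_def ip p_def)
    moreover have "Q i ! j \<in> set (induced_paths Q \<sigma> n)" using j ip by (simp add: induced_paths_def)
    ultimately have "x \<in> ?tr" using n by blast
    then show "x \<le> train_makespan \<tau> d (induced_paths Q \<sigma>) (induced_entry \<tau> \<Delta> Q \<sigma>)"
      unfolding train_makespan_def by (rule Max_ge[OF finite_train_times])
  qed simp
qed

section \<open>Optimality of a best convoy routing\<close>

theorem theorem2:
  fixes A :: "'a set" and src trg :: "'a \<Rightarrow> 'v" and s t :: 'v
    and \<tau> :: "'a \<Rightarrow> nat" and d \<Delta> :: nat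
  assumes "finite A" and "s \<noteq> t" and "d \<ge> 1" and "\<Delta> \<ge> 1"
    and "reachable A src trg s t"
  shows "\<exists>k Q \<sigma>. convoy_routing A src trg s t d k Q \<sigma> \<and>
           feasible_train_routing A src trg s t \<tau> d \<Delta> (induced_paths Q \<sigma>) (induced_entry \<tau> \<Delta> Q \<sigma>) \<and>
           train_makespan \<tau> d (induced_paths Q \<sigma>) (induced_entry \<tau> \<Delta> Q \<sigma>) = convoy_makespan \<tau> \<Delta> k Q \<sigma> \<and>
           (\<forall>Ps lam. feasible_train_routing A src trg s t \<tau> d \<Delta> Ps lam \<longrightarrow>
              convoy_makespan \<tau> \<Delta> k Q \<sigma> \<le> train_makespan \<tau> d Ps lam)"
proof -
  let ?C = "\<lambda>(k, Q, \<sigma>). convoy_routing A src trg s t d k Q \<sigma>"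
  let ?m = "\<lambda>(k, Q, \<sigma>). convoy_makespan \<tau> \<Delta> k Q \<sigma>"
  obtain P where "is_st_path A src trg s t P" using assms(5) by (auto simp: reachable_def)
  \<comment> \<open>Sending all trains along one path shows that convoy routings exist.\<close>
  then have "?C (1, \<lambda>_. P, \<lambda>_. d)" using assms(3) by (simp add: convoy_routing_def)
  \<comment> \<open>Makespans are natural numbers, so the least one is attained.\<close>
  then obtain c where c: "?C c" "\<And>c'. ?C c' \<Longrightarrow> ?m c \<le> ?m c'"
    using exists_least_iff[of "\<lambda>n. \<exists>c. ?C c \<and> ?m c = n"] by (metis (no_types, lifting) linorder_not_le)
  obtain k Q \<sigma> where [simp]: "c = (k, Q, \<sigma>)" by (cases c)
  have conv: "convoy_routing A src trg s t d k Q \<sigma>" using c(1) by simp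
  have "convoy_makespan \<tau> \<Delta> k Q \<sigma> \<le> train_makespan \<tau> d Ps lam"
    if feas: "feasible_train_routing A src trg s t \<tau> d \<Delta> Ps lam" for Ps lam
  proof -
    \<comment> \<open>With the makespan of the given routing as \<open>T\<close>, the convoy routing
      built from it is no slower, and the best one is no slower than that.\<close>
    interpret train_routing A src trg s t \<tau> d \<Delta> Ps lam "train_makespan \<tau> d Ps lam"
    proof
      show "lam i a + \<tau> a \<le> train_makespan \<tau> d Ps lam" if "i < d" "a \<in> set (Ps i)" for i a
        unfolding train_makespan_def using that by (intro Max_ge finite_train_times) blast
    qed (use feas assms in auto)
    obtain k' Q' \<sigma>' where "convoy_routing A src trg s t d k' Q' \<sigma>'"
      "convoy_makespan \<tau> \<Delta> k' Q' \<sigma>' \<le> train_makespan \<tau> d Ps lam"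
      using ex_convoy assms by blast
    then show ?thesis using c(2)[of "(k', Q', \<sigma>')"] by simp
  qed
  then show ?thesis
    using conv induced_feasible[OF conv] induced_makespan[OF conv assms(3)] by blast
qed

end
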